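(* Let $\boldsymbol{x}^*\in\mathbb{R}^{N_D}$ be a solution of the domain-decomposed full order model (DD-FOM), i.e. $\boldsymbol{r}_i(\boldsymbol{x}_i^{\Omega*},\boldsymbol{x}_i^{\Gamma*})=\boldsymbol{0}$ for $i=1,\dots,n_\Omega$ and $\sum_{i=1}^{n_\Omega}\boldsymbol{A}_i\boldsymbol{x}_i^{\Gamma*}=\boldsymbol{0}$. Let $\widehat{\boldsymbol{x}}^*\in\mathbb{R}^{n_D}$ be a solution of the reduced order model (ROM) $$\min_{\widehat{\boldsymbol{x}}}\ \frac12\sum_{i=1}^{n_\Omega}\big\|\boldsymbol{B}_i\boldsymbol{r}_i\big(\boldsymbol{g}_i^\Omega(\widehat{\boldsymbol{x}}_i^\Omega),\boldsymbol{g}_i^\Gamma(\widehat{\boldsymbol{x}}_i^\Gamma)\big)\big\|_2^2\quad\text{s.t.}\quad\sum_{i=1}^{n_\Omega}\widetilde{\boldsymbol{A}}_i(\widehat{\boldsymbol{x}}_i^\Gamma)=\boldsymbol{0},$$ in either the weak FOM-port constraint formulation or the strong ROM-port constraint formulation, and let $\mathcal{S}_{\rm ROM}$ denote the feasible set of this problem. Suppose there exist $\kappa_\ell>0$, $P>0$ and $\kappa_u>0$ such that $$\Big(\sum_{i=1}^{n_\Omega}\|\boldsymbol{r}_i(\boldsymbol{y}_i^\Omega,\boldsymbol{y}_i^\Gamma)-\boldsymbol{r}_i(\boldsymbol{z}_i^\Omega,\boldsymbol{z}_i^\Gamma)\|_2^2\Big)^{1/2}\ge\kappa_\ell\|\boldsymbol{y}-\boldsymbol{z}\|_2\qquad\forall\,\boldsymbol{y},\boldsymbol{z}\in\mathbb{R}^{N_D},$$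 $$\Big(\sum_{i=1}^{n_\Omega}\|\boldsymbol{B}_i\boldsymbol{r}_i(\boldsymbol{y}_i^\Omega,\boldsymbol{y}_i^\Gamma)\|_2^2\Big)^{1/2}\ge P\Big(\sum_{i=1}^{n_\Omega}\|\boldsymbol{r}_i(\boldsymbol{y}_i^\Omega,\boldsymbol{y}_i^\Gamma)\|_2^2\Big)^{1/2}\qquad\forall\,\boldsymbol{y}\in\boldsymbol{g}(\mathcal{S}_{\rm ROM}),$$ $$\Big(\sum_{i=1}^{n_\Omega}\|\boldsymbol{B}_i\boldsymbol{r}_i(\boldsymbol{y}_i^\Omega,\boldsymbol{y}_i^\Gamma)-\boldsymbol{B}_i\boldsymbol{r}_i(\boldsymbol{z}_i^\Omega,\boldsymbol{z}_i^\Gamma)\|_2^2\Big)^{1/2}\le\kappa_u\|\boldsymbol{y}-\boldsymbol{z}\|_2\qquad\forall\,\boldsymbol{y},\boldsymbol{z}\in\mathbb{R}^{N_D}.$$ Then $$\|\boldsymbol{x}^*-\boldsymbol{g}(\widehat{\boldsymbol{x}}^* )\|_2\le\frac{\kappa_u}{P\kappa_\ell}\inf_{\widehat{\boldsymbol{w}}\in\mathcal{S}_{\rm ROM}}\|\boldsymbol{x}^*-\boldsymbol{g}(\widehat{\boldsymbol{w}})\|_2.$$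
   Context: There are $n_\Omega$ subdomains. For each $i=1,\dots,n_\Omega$: $\boldsymbol{r}_i:\mathbb{R}^{N_i^\Omega}\times\mathbb{R}^{N_i^\Gamma}\to\mathbb{R}^{N_i^r}$ is the subdomain residual function of the full order model; $\boldsymbol{A}_i\in\{-1,0,1\}^{N_A\times N_i^\Gamma}$ are the constraint matrices expressing equality of the duplicated interface state variables of neighboring subdomains; $\boldsymbol{B}_i\in\mathbb{R}^{N_i^B\times N_i^r}$, $N_i^B\le N_i^r$, is a given hyper-reduction matrix; $\boldsymbol{g}_i^\Omega:\mathbb{R}^{n_i^\Omega}\to\mathbb{R}^{N_i^\Omega}$ and $\boldsymbol{g}_i^\Gamma:\mathbb{R}^{n_i^\Gamma}\to\mathbb{R}^{N_i^\Gamma}$ are given maps from reduced to full subdomain states. Notation: $N_D=\sum_i(N_i^\Omega+N_i^\Gamma)$, $n_D=\sum_i(n_i^\Omega+n_i^\Gamma)$. A vector $\boldsymbol{y}\in\mathbb{R}^{N_D}$ is written in blocks $\boldsymbol{y}=(\boldsymbol{y}_1^\Omega,\boldsymbol{y}_1^\Gamma,\dots,\boldsymbol{y}_{n_\Omega}^\Omega,\boldsymbol{y}_{n_\Omega}^\Gamma)$ with $\boldsymbol{y}_i^\Omega\in\mathbb{R}^{N_i^\Omega}$, $\boldsymbol{y}_i^\Gamma\in\mathbb{R}^{N_i^\Gamma}$, and analogously $\widehat{\boldsymbol{x}}=(\widehat{\boldsymbol{x}}_1^\Omega,\widehat{\boldsymbol{x}}_1^\Gamma,\dots,\widehat{\boldsymbol{x}}_{n_\Omega}^\Omega,\widehat{\boldsymbol{x}}_{n_\Omega}^\Gamma)\in\mathbb{R}^{n_D}$.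 The lifting map is $\boldsymbol{g}(\widehat{\boldsymbol{x}})=(\boldsymbol{g}_1^\Omega(\widehat{\boldsymbol{x}}_1^\Omega),\boldsymbol{g}_1^\Gamma(\widehat{\boldsymbol{x}}_1^\Gamma),\dots,\boldsymbol{g}_{n_\Omega}^\Omega(\widehat{\boldsymbol{x}}_{n_\Omega}^\Omega),\boldsymbol{g}_{n_\Omega}^\Gamma(\widehat{\boldsymbol{x}}_{n_\Omega}^\Gamma))\in\mathbb{R}^{N_D}$. The ROM constraint functions $\widetilde{\boldsymbol{A}}_i$ are one of the following. Weak FOM-port constraints: $\widetilde{\boldsymbol{A}}_i(\widehat{\boldsymbol{x}}_i^\Gamma)=\boldsymbol{C}\boldsymbol{A}_i\boldsymbol{g}_i^\Gamma(\widehat{\boldsymbol{x}}_i^\Gamma)$ with a given matrix $\boldsymbol{C}\in\mathbb{R}^{n_C\times N_A}$. Strong ROM-port constraints: $\widetilde{\boldsymbol{A}}_i(\widehat{\boldsymbol{x}}_i^\Gamma)=\widehat{\boldsymbol{A}}_i\widehat{\boldsymbol{x}}_i^\Gamma$ with given matrices $\widehat{\boldsymbol{A}}_i\in\{-1,0,1\}^{n_A\times n_i^\Gamma}$ encoding equality of shared reduced port variables (in this formulation the maps $\boldsymbol{g}_i^\Gamma$ are assembled from maps on the individual ports, i.e. on the groups of interface variables shared by a set of subdomains, so that equality of the reduced port variables implies $\sum_i\boldsymbol{A}_i\boldsymbol{g}_i^\Gamma(\widehat{\boldsymbol{x}}_i^\Gamma)=\boldsymbol{0}$). The feasible set is $\mathcal{S}_{\rm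 ROM}=\{\widehat{\boldsymbol{x}}\in\mathbb{R}^{n_D}:\sum_{i=1}^{n_\Omega}\widetilde{\boldsymbol{A}}_i(\widehat{\boldsymbol{x}}_i^\Gamma)=\boldsymbol{0}\}$. *)

theory Defs
  imports "Jordan_Normal_Form.Matrix" "HOL-Analysis.L2_Norm"
begin

definition l2_norm :: "real vec \<Rightarrow> real" where
  "l2_norm v = L2_set (\<lambda>i. v $ i) {..<dim_vec v}"

text \<open>
  Subdomains are numbered \<open>0, \<dots>, n - 1\<close>. A vector over all subdomains is a plain vector of
  dimension \<open>\<Sum>i<n. d\<Omega> i + d\<Gamma> i\<close>, whose entries are grouped as
  \<open>(y\<Omega> 0, y\<Gamma> 0, y\<Omega> 1, y\<Gamma> 1, \<dots>)\<close>.
\<close>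

definition dd_dim :: "(nat \<Rightarrow> nat) \<Rightarrow> (nat \<Rightarrow> nat) \<Rightarrow> nat \<Rightarrow> nat" where
  "dd_dim d\<Omega> d\<Gamma> n = (\<Sum>i<n. d\<Omega> i + d\<Gamma> i)"

text \<open>The blocks of subdomain \<open>i\<close> start at position \<open>dd_dim d\<Omega> d\<Gamma> i\<close>.\<close>

definition interior_block :: "(nat \<Rightarrow> nat) \<Rightarrow> (nat \<Rightarrow> nat) \<Rightarrow> nat \<Rightarrow> real vec \<Rightarrow> real vec" where
  "interior_block d\<Omega> d\<Gamma> i y = vec (d\<Omega> i) (\<lambda>k. y $ (dd_dim d\<Omega> d\<Gamma> i + k))"

definition interface_block :: "(nat \<Rightarrow> nat) \<Rightarrow> (nat \<Rightarrow> nat) \<Rightarrow> nat \<Rightarrow> real vec \<Rightarrow> real vec" where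
  "interface_block d\<Omega> d\<Gamma> i y = vec (d\<Gamma> i) (\<lambda>k. y $ (dd_dim d\<Omega> d\<Gamma> i + d\<Omega> i + k))"

primrec stack_blocks :: "(nat \<Rightarrow> real vec) \<Rightarrow> (nat \<Rightarrow> real vec) \<Rightarrow> nat \<Rightarrow> real vec" where
  "stack_blocks u v 0 = 0\<^sub>v 0"
| "stack_blocks u v (Suc n) = stack_blocks u v n @\<^sub>v (u n @\<^sub>v v n)"

definition lift_map ::
  "nat \<Rightarrow> (nat \<Rightarrow> nat) \<Rightarrow> (nat \<Rightarrow> nat) \<Rightarrow> (nat \<Rightarrow> real vec \<Rightarrow> real vec) \<Rightarrow> (nat \<Rightarrow> real vec \<Rightarrow> real vec)
    \<Rightarrow> real vec \<Rightarrow> real vec" where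
  "lift_map nsub n\<Omega> n\<Gamma> g\<Omega> g\<Gamma> x =
     stack_blocks (\<lambda>i. g\<Omega> i (interior_block n\<Omega> n\<Gamma> i x)) (\<lambda>i. g\<Gamma> i (interface_block n\<Omega> n\<Gamma> i x)) nsub"

lemma dd_dim_simps [simp]:
  "dd_dim d\<Omega> d\<Gamma> 0 = 0"
  "dd_dim d\<Omega> d\<Gamma> (Suc n) = dd_dim d\<Omega> d\<Gamma> n + (d\<Omega> n + d\<Gamma> n)"
  by (simp_all add: dd_dim_def)

lemma dd_dim_mono: "m \<le> n \<Longrightarrow> dd_dim d\<Omega> d\<Gamma> m \<le> dd_dim d\<Omega> d\<Gamma> n"
  unfolding dd_dim_def by (rule sum_mono2) auto

lemma block_carrier [simp]:
  "interior_block d\<Omega> d\<Gamma> i y \<in> carrier_vec (d\<Omega> i)"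
  "interface_block d\<Omega> d\<Gamma> i y \<in> carrier_vec (d\<Gamma> i)"
  by (simp_all add: interior_block_def interface_block_def)

lemma stack_blocks_carrier:
  assumes "\<forall>i<n. u i \<in> carrier_vec (d\<Omega> i)" and "\<forall>i<n. v i \<in> carrier_vec (d\<Gamma> i)"
  shows "stack_blocks u v n \<in> carrier_vec (dd_dim d\<Omega> d\<Gamma> n)"
  using assms by (induction n) auto

lemma interior_block_stack_blocks:
  assumes "\<forall>i<n. u i \<in> carrier_vec (d\<Omega> i)" and "\<forall>i<n. v i \<in> carrier_vec (d\<Gamma> i)" and "i < n"
  shows "interior_block d\<Omega> d\<Gamma> i (stack_blocks u v n) = u i"
  using assms
proof (induction n)
  case (Suc n)
  have c: "stack_blocks u v n \<in> carrier_vec (dd_dim d\<Omega> d\<Gamma> n)"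
    using Suc.prems by (intro stack_blocks_carrier) auto
  have un: "u n \<in> carrier_vec (d\<Omega> n)" and vn: "v n \<in> carrier_vec (d\<Gamma> n)"
    using Suc.prems by auto
  show ?case
  proof (cases "i = n")
    case True
    show ?thesis unfolding True using un vn c
      by (intro eq_vecI) (auto simp: interior_block_def)
  next
    case False
    then have i: "i < n" using Suc.prems by simp
    then have le: "dd_dim d\<Omega> d\<Gamma> i + (d\<Omega> i + d\<Gamma> i) \<le> dd_dim d\<Omega> d\<Gamma> n"
      using dd_dim_mono[of "Suc i" n d\<Omega> d\<Gamma>] by simp
    have "interior_block d\<Omega> d\<Gamma> i (stack_blocks u v (Suc n))
        = interior_block d\<Omega> d\<Gamma> i (stack_blocks u v n)"
      using un vn c le by (intro eq_vecI) (auto simp: interior_block_def)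
    then show ?thesis using Suc i by simp
  qed
qed simp

lemma interface_block_stack_blocks:
  assumes "\<forall>i<n. u i \<in> carrier_vec (d\<Omega> i)" and "\<forall>i<n. v i \<in> carrier_vec (d\<Gamma> i)" and "i < n"
  shows "interface_block d\<Omega> d\<Gamma> i (stack_blocks u v n) = v i"
  using assms
proof (induction n)
  case (Suc n)
  have c: "stack_blocks u v n \<in> carrier_vec (dd_dim d\<Omega> d\<Gamma> n)"
    using Suc.prems by (intro stack_blocks_carrier) auto
  have un: "u n \<in> carrier_vec (d\<Omega> n)" and vn: "v n \<in> carrier_vec (d\<Gamma> n)"
    using Suc.prems by auto
  show ?case
  proof (cases "i = n")
    case True
    show ?thesis unfolding True using un vn c
      by (intro eq_vecI) (auto simp: interface_block_def)
  next
    case False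
    then have i: "i < n" using Suc.prems by simp
    then have le: "dd_dim d\<Omega> d\<Gamma> i + (d\<Omega> i + d\<Gamma> i) \<le> dd_dim d\<Omega> d\<Gamma> n"
      using dd_dim_mono[of "Suc i" n d\<Omega> d\<Gamma>] by simp
    have "interface_block d\<Omega> d\<Gamma> i (stack_blocks u v (Suc n))
        = interface_block d\<Omega> d\<Gamma> i (stack_blocks u v n)"
      using un vn c le by (intro eq_vecI) (auto simp: interface_block_def)
    then show ?thesis using Suc i by simp
  qed
qed simp

text \<open>
  \<open>Q i\<close> is the set of ports of subdomain \<open>i\<close>, so a port \<open>p\<close> is shared by the subdomains \<open>i\<close> with
  \<open>p \<in> Q i\<close>, and \<open>dp p\<close> is the number of variables on \<open>p\<close>. The numbering says which shared variable
  each local interface variable duplicates: \<open>lab i k = (p, q)\<close> if entry \<open>k\<close> of the interface vector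
  of subdomain \<open>i\<close> is the local copy of variable \<open>q\<close> on port \<open>p\<close>. The same notion is used for the
  full and for the reduced interface variables.
\<close>

definition port_numbering ::
  "nat \<Rightarrow> (nat \<Rightarrow> nat) \<Rightarrow> (nat \<Rightarrow> nat set) \<Rightarrow> (nat \<Rightarrow> nat) \<Rightarrow> (nat \<Rightarrow> nat \<Rightarrow> nat \<times> nat) \<Rightarrow> bool" where
  "port_numbering nsub d\<Gamma> Q dp lab \<longleftrightarrow>
     (\<forall>i<nsub. bij_betw (lab i) {..<d\<Gamma> i} (SIGMA p:Q i. {..<dp p}))"

definition equality_constraints ::
  "nat \<Rightarrow> (nat \<Rightarrow> nat) \<Rightarrow> (nat \<Rightarrow> nat \<Rightarrow> nat \<times> nat) \<Rightarrow> nat \<Rightarrow> (nat \<Rightarrow> real mat) \<Rightarrow> bool" where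
  "equality_constraints nsub d\<Gamma> lab m M \<longleftrightarrow>
     (\<forall>i<nsub. M i \<in> carrier_mat m (d\<Gamma> i) \<and> elements_mat (M i) \<subseteq> {-1, 0, 1}) \<and>
     (\<forall>v. (\<forall>i<nsub. v i \<in> carrier_vec (d\<Gamma> i)) \<longrightarrow>
        (finsum_vec TYPE(real) m (\<lambda>i. M i *\<^sub>v v i) {..<nsub} = 0\<^sub>v m \<longleftrightarrow>
         (\<forall>i<nsub. \<forall>j<nsub. \<forall>k<d\<Gamma> i. \<forall>l<d\<Gamma> j. lab i k = lab j l \<longrightarrow> v i $ k = v j $ l)))"

text \<open>The variables on port \<open>p\<close> contained in an interface vector of subdomain \<open>i\<close>.\<close>

definition port_part ::
  "(nat \<Rightarrow> nat) \<Rightarrow> (nat \<Rightarrow> nat) \<Rightarrow> (nat \<Rightarrow> nat \<Rightarrow> nat \<times> nat) \<Rightarrow> nat \<Rightarrow> nat \<Rightarrow> real vec \<Rightarrow> real vec" where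
  "port_part d\<Gamma> dp lab i p v = vec (dp p) (\<lambda>q. v $ inv_into {..<d\<Gamma> i} (lab i) (p, q))"

text \<open>
  Port-wise assembly of the interface maps: the map \<open>gp p\<close> on a port is the same for all the
  subdomains sharing it.
\<close>

definition assembled_from_ports ::
  "nat \<Rightarrow> (nat \<Rightarrow> nat) \<Rightarrow> (nat \<Rightarrow> nat) \<Rightarrow> (nat \<Rightarrow> nat set)
    \<Rightarrow> (nat \<Rightarrow> nat) \<Rightarrow> (nat \<Rightarrow> nat \<Rightarrow> nat \<times> nat) \<Rightarrow> (nat \<Rightarrow> nat) \<Rightarrow> (nat \<Rightarrow> nat \<Rightarrow> nat \<times> nat)
    \<Rightarrow> (nat \<Rightarrow> real vec \<Rightarrow> real vec) \<Rightarrow> (nat \<Rightarrow> real vec \<Rightarrow> real vec) \<Rightarrow> bool" where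
  "assembled_from_ports nsub N\<Gamma> n\<Gamma> Q Np lab np rlab gp g\<Gamma> \<longleftrightarrow>
     (\<forall>i<nsub. \<forall>p\<in>Q i. gp p \<in> carrier_vec (np p) \<rightarrow> carrier_vec (Np p) \<and>
        (\<forall>v\<in>carrier_vec (n\<Gamma> i).
           port_part N\<Gamma> Np lab i p (g\<Gamma> i v) = gp p (port_part n\<Gamma> np rlab i p v)))"

definition dd_fom_solution ::
  "nat \<Rightarrow> (nat \<Rightarrow> nat) \<Rightarrow> (nat \<Rightarrow> nat) \<Rightarrow> (nat \<Rightarrow> nat) \<Rightarrow> (nat \<Rightarrow> real vec \<Rightarrow> real vec \<Rightarrow> real vec)
    \<Rightarrow> nat \<Rightarrow> (nat \<Rightarrow> real mat) \<Rightarrow> real vec \<Rightarrow> bool" where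
  "dd_fom_solution nsub N\<Omega> N\<Gamma> Nr r NA A x \<longleftrightarrow>
     x \<in> carrier_vec (dd_dim N\<Omega> N\<Gamma> nsub) \<and>
     (\<forall>i<nsub. r i (interior_block N\<Omega> N\<Gamma> i x) (interface_block N\<Omega> N\<Gamma> i x) = 0\<^sub>v (Nr i)) \<and>
     finsum_vec TYPE(real) NA (\<lambda>i. A i *\<^sub>v interface_block N\<Omega> N\<Gamma> i x) {..<nsub} = 0\<^sub>v NA"

definition weak_FOM_port_constraints ::
  "nat \<Rightarrow> (nat \<Rightarrow> nat) \<Rightarrow> nat \<Rightarrow> (nat \<Rightarrow> real mat) \<Rightarrow> (nat \<Rightarrow> real vec \<Rightarrow> real vec)
    \<Rightarrow> nat \<Rightarrow> real mat \<Rightarrow> (nat \<Rightarrow> real vec \<Rightarrow> real vec) \<Rightarrow> bool" where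
  "weak_FOM_port_constraints nsub n\<Gamma> NA A g\<Gamma> m C At \<longleftrightarrow>
     C \<in> carrier_mat m NA \<and>
     (\<forall>i<nsub. \<forall>v\<in>carrier_vec (n\<Gamma> i). At i v = C *\<^sub>v (A i *\<^sub>v g\<Gamma> i v))"

definition strong_ROM_port_constraints ::
  "nat \<Rightarrow> (nat \<Rightarrow> nat) \<Rightarrow> (nat \<Rightarrow> nat) \<Rightarrow> (nat \<Rightarrow> nat set)
    \<Rightarrow> (nat \<Rightarrow> nat) \<Rightarrow> (nat \<Rightarrow> nat \<Rightarrow> nat \<times> nat) \<Rightarrow> (nat \<Rightarrow> nat) \<Rightarrow> (nat \<Rightarrow> nat \<Rightarrow> nat \<times> nat)
    \<Rightarrow> (nat \<Rightarrow> real vec \<Rightarrow> real vec) \<Rightarrow> (nat \<Rightarrow> real vec \<Rightarrow> real vec)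
    \<Rightarrow> nat \<Rightarrow> (nat \<Rightarrow> real mat) \<Rightarrow> (nat \<Rightarrow> real vec \<Rightarrow> real vec) \<Rightarrow> bool" where
  "strong_ROM_port_constraints nsub N\<Gamma> n\<Gamma> Q Np lab np rlab gp g\<Gamma> m Ahat At \<longleftrightarrow>
     port_numbering nsub n\<Gamma> Q np rlab \<and>
     equality_constraints nsub n\<Gamma> rlab m Ahat \<and>
     assembled_from_ports nsub N\<Gamma> n\<Gamma> Q Np lab np rlab gp g\<Gamma> \<and>
     (\<forall>i<nsub. \<forall>v\<in>carrier_vec (n\<Gamma> i). At i v = Ahat i *\<^sub>v v)"

text \<open>Equality of the reduced port variables implies compatibility of the lifted interface states.\<close>

lemma strong_ROM_port_compatible:
  assumes "port_numbering nsub N\<Gamma> Q Np lab"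
    and "equality_constraints nsub N\<Gamma> lab NA A"
    and "\<forall>i<nsub. g\<Gamma> i \<in> carrier_vec (n\<Gamma> i) \<rightarrow> carrier_vec (N\<Gamma> i)"
    and "strong_ROM_port_constraints nsub N\<Gamma> n\<Gamma> Q Np lab np rlab gp g\<Gamma> m Ahat At"
    and v: "\<forall>i<nsub. v i \<in> carrier_vec (n\<Gamma> i)"
    and sum0: "finsum_vec TYPE(real) m (\<lambda>i. Ahat i *\<^sub>v v i) {..<nsub} = 0\<^sub>v m"
  shows "finsum_vec TYPE(real) NA (\<lambda>i. A i *\<^sub>v g\<Gamma> i (v i)) {..<nsub} = 0\<^sub>v NA"
proof -
  have num: "port_numbering nsub n\<Gamma> Q np rlab"
    and eq: "equality_constraints nsub n\<Gamma> rlab m Ahat"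
    and asm: "assembled_from_ports nsub N\<Gamma> n\<Gamma> Q Np lab np rlab gp g\<Gamma>"
    using assms(4) by (auto simp: strong_ROM_port_constraints_def)
  have shared: "v i $ k = v j $ l"
    if "i < nsub" "j < nsub" "k < n\<Gamma> i" "l < n\<Gamma> j" "rlab i k = rlab j l" for i j k l
    using eq v sum0 that unfolding equality_constraints_def by blast
  have "g\<Gamma> i (v i) $ k = g\<Gamma> j (v j) $ l"
    if i: "i < nsub" and j: "j < nsub" and k: "k < N\<Gamma> i" and l: "l < N\<Gamma> j"
      and lab: "lab i k = lab j l" for i j k l
  proof -
    obtain p q where pq: "lab i k = (p, q)" by fastforce
    have bi: "bij_betw (lab i) {..<N\<Gamma> i} (SIGMA p:Q i. {..<Np p})"
      and bj: "bij_betw (lab j) {..<N\<Gamma> j} (SIGMA p:Q j. {..<Np p})"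
      using assms(1) i j by (auto simp: port_numbering_def)
    have ri: "bij_betw (rlab i) {..<n\<Gamma> i} (SIGMA p:Q i. {..<np p})"
      and rj: "bij_betw (rlab j) {..<n\<Gamma> j} (SIGMA p:Q j. {..<np p})"
      using num i j by (auto simp: port_numbering_def)
    have "(p, q) \<in> (SIGMA p:Q i. {..<Np p})" using bij_betwE[OF bi] k pq by force
    moreover have "(p, q) \<in> (SIGMA p:Q j. {..<Np p})" using bij_betwE[OF bj] l pq lab by force
    ultimately have p: "p \<in> Q i" "p \<in> Q j" and q: "q < Np p" by auto
    have "port_part n\<Gamma> np rlab i p (v i) = port_part n\<Gamma> np rlab j p (v j)"
    proof (rule eq_vecI)
      fix s assume "s < dim_vec (port_part n\<Gamma> np rlab j p (v j))"
      then have s: "s < np p" by (simp add: port_part_def)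
      have "(p, s) \<in> rlab i ` {..<n\<Gamma> i}" "(p, s) \<in> rlab j ` {..<n\<Gamma> j}"
        using ri rj p s by (auto simp: bij_betw_def)
      then have "v i $ inv_into {..<n\<Gamma> i} (rlab i) (p, s) = v j $ inv_into {..<n\<Gamma> j} (rlab j) (p, s)"
        using inv_into_into[of "(p, s)" "rlab i" "{..<n\<Gamma> i}"] inv_into_into[of "(p, s)" "rlab j" "{..<n\<Gamma> j}"]
        by (intro shared i j) (simp_all add: f_inv_into_f)
      then show "port_part n\<Gamma> np rlab i p (v i) $ s = port_part n\<Gamma> np rlab j p (v j) $ s"
        using s by (simp add: port_part_def)
    qed (simp add: port_part_def)
    then have "port_part N\<Gamma> Np lab i p (g\<Gamma> i (v i)) = port_part N\<Gamma> Np lab j p (g\<Gamma> j (v j))"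
      using asm i j p v by (simp add: assembled_from_ports_def)
    then have "port_part N\<Gamma> Np lab i p (g\<Gamma> i (v i)) $ q = port_part N\<Gamma> Np lab j p (g\<Gamma> j (v j)) $ q"
      by simp
    moreover have "inv_into {..<N\<Gamma> i} (lab i) (p, q) = k" "inv_into {..<N\<Gamma> j} (lab j) (p, q) = l"
      using bi bj k l pq lab by (auto simp: bij_betw_def intro: inv_into_f_eq)
    ultimately show ?thesis using q by (simp add: port_part_def)
  qed
  then have shared': "\<forall>i<nsub. \<forall>j<nsub. \<forall>k<N\<Gamma> i. \<forall>l<N\<Gamma> j.
      lab i k = lab j l \<longrightarrow> g\<Gamma> i (v i) $ k = g\<Gamma> j (v j) $ l"
    by blast
  have carr: "\<forall>i<nsub. g\<Gamma> i (v i) \<in> carrier_vec (N\<Gamma> i)"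
    using assms(3) v by auto
  note mp = assms(2)[unfolded equality_constraints_def, THEN conjunct2, rule_format,
      of "\<lambda>i. g\<Gamma> i (v i)", THEN iffD2]
  show ?thesis
    by (rule mp) (use carr shared' in blast)+
qed

definition rom_feasible_set ::
  "nat \<Rightarrow> (nat \<Rightarrow> nat) \<Rightarrow> (nat \<Rightarrow> nat) \<Rightarrow> nat \<Rightarrow> (nat \<Rightarrow> real vec \<Rightarrow> real vec) \<Rightarrow> real vec set" where
  "rom_feasible_set nsub n\<Omega> n\<Gamma> m At =
     {x \<in> carrier_vec (dd_dim n\<Omega> n\<Gamma> nsub).
        finsum_vec TYPE(real) m (\<lambda>i. At i (interface_block n\<Omega> n\<Gamma> i x)) {..<nsub} = 0\<^sub>v m}"

definition rom_objective ::
  "nat \<Rightarrow> (nat \<Rightarrow> nat) \<Rightarrow> (nat \<Rightarrow> nat) \<Rightarrow> (nat \<Rightarrow> real vec \<Rightarrow> real vec \<Rightarrow> real vec) \<Rightarrow> (nat \<Rightarrow> real mat)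
    \<Rightarrow> (nat \<Rightarrow> real vec \<Rightarrow> real vec) \<Rightarrow> (nat \<Rightarrow> real vec \<Rightarrow> real vec) \<Rightarrow> real vec \<Rightarrow> real" where
  "rom_objective nsub n\<Omega> n\<Gamma> r B g\<Omega> g\<Gamma> x =
     1 / 2 * (\<Sum>i<nsub. (l2_norm (B i *\<^sub>v
       r i (g\<Omega> i (interior_block n\<Omega> n\<Gamma> i x)) (g\<Gamma> i (interface_block n\<Omega> n\<Gamma> i x))))\<^sup>2)"

definition rom_solution ::
  "nat \<Rightarrow> (nat \<Rightarrow> nat) \<Rightarrow> (nat \<Rightarrow> nat) \<Rightarrow> (nat \<Rightarrow> real vec \<Rightarrow> real vec \<Rightarrow> real vec) \<Rightarrow> (nat \<Rightarrow> real mat)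
    \<Rightarrow> (nat \<Rightarrow> real vec \<Rightarrow> real vec) \<Rightarrow> (nat \<Rightarrow> real vec \<Rightarrow> real vec)
    \<Rightarrow> nat \<Rightarrow> (nat \<Rightarrow> real vec \<Rightarrow> real vec) \<Rightarrow> real vec \<Rightarrow> bool" where
  "rom_solution nsub n\<Omega> n\<Gamma> r B g\<Omega> g\<Gamma> m At x \<longleftrightarrow>
     is_arg_min (rom_objective nsub n\<Omega> n\<Gamma> r B g\<Omega> g\<Gamma>) (\<lambda>w. w \<in> rom_feasible_set nsub n\<Omega> n\<Gamma> m At) x"

end

theory Submission
  imports Defs
begin

text \<open>
  The bound is a Cea-type quasi-optimality argument for residual minimization. The FOM solution has zero residual, so
  the lower Lipschitz bound makes the residual of a lifted state control its distance to \<open>xs\<close>, and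
  the upper Lipschitz bound makes that distance control the hyper-reduced residual. Minimality of
  \<open>xh\<close> links the two: for every feasible \<open>w\<close>, writing \<open>R\<close> and \<open>R\<^sub>B\<close> for the norms of the full and
  of the hyper-reduced residual at a lifted state,
  \<open>P * \<kappa>l * \<parallel>xs - g xh\<parallel> \<le> P * R xh \<le> R\<^sub>B xh \<le> R\<^sub>B w \<le> \<kappa>u * \<parallel>xs - g w\<parallel>\<close>.
  Lemma \<open>residual_minimizer_quasi_optimal\<close> carries out this chain, and the other lemmas bring the
  block-wise expressions for \<open>R\<close> and \<open>R\<^sub>B\<close>, and the ROM objective \<open>R\<^sub>B\<^sup>2 / 2\<close>, into its form. The
  argument is the same for the weak and the strong constraints, because the minimum and the infimum
  are taken over the same feasible set.
\<close>

text \<open>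
  The chain of estimates for an arbitrary error measure \<open>E\<close>: \<open>R\<close> bounds the error of the minimizer
  from above, and the minimized quantity \<open>RB\<close> is bounded by the error of every competitor.
\<close>

lemma residual_minimizer_quasi_optimal:
  fixes E R RB :: "'a \<Rightarrow> real" and \<kappa>l P \<kappa>u :: real
  assumes min: "is_arg_min RB (\<lambda>w. w \<in> S) x"
    and pos: "\<kappa>l > 0" "P > 0" "\<kappa>u > 0"
    and stable: "\<kappa>l * E x \<le> R x"
    and reduced: "P * R x \<le> RB x"
    and bounded: "\<And>w. w \<in> S \<Longrightarrow> RB w \<le> \<kappa>u * E w"
  shows "E x \<le> \<kappa>u / (P * \<kappa>l) * (INF w\<in>S. E w)"
proof -
  have x: "x \<in> S" and least: "\<And>w. w \<in> S \<Longrightarrow> RB x \<le> RB w"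
    using min by (auto simp: is_arg_min_linorder)
  have "P * \<kappa>l / \<kappa>u * E x \<le> (INF w\<in>S. E w)"
  proof (rule cINF_greatest)
    fix w assume w: "w \<in> S"
    have "P * (\<kappa>l * E x) \<le> P * R x"
      using stable pos by simp
    also have "\<dots> \<le> RB x" by (fact reduced)
    also have "\<dots> \<le> RB w" by (rule least[OF w])
    also have "\<dots> \<le> \<kappa>u * E w" by (rule bounded[OF w])
    finally show "P * \<kappa>l / \<kappa>u * E x \<le> E w"
      using pos by (simp add: field_simps)
  qed (use x in auto)
  then show ?thesis
    using pos by (simp add: field_simps)
qed

lemma l2_norm_minus_commute:
  assumes "dim_vec v = dim_vec w"
  shows "l2_norm (v - w) = l2_norm (w - v)"
  using assms unfolding l2_norm_def L2_set_def
  by (auto intro!: arg_cong[where f = sqrt] sum.cong power2_commute)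

lemma lift_map_carrier:
  assumes "\<forall>i<n. g\<Omega> i \<in> carrier_vec (n\<Omega> i) \<rightarrow> carrier_vec (N\<Omega> i)"
    and "\<forall>i<n. g\<Gamma> i \<in> carrier_vec (n\<Gamma> i) \<rightarrow> carrier_vec (N\<Gamma> i)"
  shows "lift_map n n\<Omega> n\<Gamma> g\<Omega> g\<Gamma> x \<in> carrier_vec (dd_dim N\<Omega> N\<Gamma> n)"
  unfolding lift_map_def
  by (rule stack_blocks_carrier) (use assms in \<open>simp_all add: Pi_iff\<close>)

lemma blocks_lift_map:
  assumes "\<forall>i<n. g\<Omega> i \<in> carrier_vec (n\<Omega> i) \<rightarrow> carrier_vec (N\<Omega> i)"
    and "\<forall>i<n. g\<Gamma> i \<in> carrier_vec (n\<Gamma> i) \<rightarrow> carrier_vec (N\<Gamma> i)"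
    and "i < n"
  shows "interior_block N\<Omega> N\<Gamma> i (lift_map n n\<Omega> n\<Gamma> g\<Omega> g\<Gamma> x) = g\<Omega> i (interior_block n\<Omega> n\<Gamma> i x)"
    and "interface_block N\<Omega> N\<Gamma> i (lift_map n n\<Omega> n\<Gamma> g\<Omega> g\<Gamma> x) = g\<Gamma> i (interface_block n\<Omega> n\<Gamma> i x)"
  unfolding lift_map_def
  by (rule interior_block_stack_blocks interface_block_stack_blocks;
      use assms in \<open>simp_all add: Pi_iff\<close>)+

text \<open>
  The objective is half the square of the hyper-reduced residual norm at the lifted state, and
  \<open>t \<mapsto> t\<^sup>2 / 2\<close> is strictly increasing on nonnegative reals, so both have the same minimizers.
\<close>

lemma rom_solution_minimizes_residual_norm:
  assumes g\<Omega>: "\<forall>i<n. g\<Omega> i \<in> carrier_vec (n\<Omega> i) \<rightarrow> carrier_vec (N\<Omega> i)"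
    and g\<Gamma>: "\<forall>i<n. g\<Gamma> i \<in> carrier_vec (n\<Gamma> i) \<rightarrow> carrier_vec (N\<Gamma> i)"
    and rom: "rom_solution n n\<Omega> n\<Gamma> r B g\<Omega> g\<Gamma> m At x"
  shows "is_arg_min
    (\<lambda>w. sqrt (\<Sum>i<n. (l2_norm (B i *\<^sub>v
       r i (interior_block N\<Omega> N\<Gamma> i (lift_map n n\<Omega> n\<Gamma> g\<Omega> g\<Gamma> w))
           (interface_block N\<Omega> N\<Gamma> i (lift_map n n\<Omega> n\<Gamma> g\<Omega> g\<Gamma> w))))\<^sup>2))
    (\<lambda>w. w \<in> rom_feasible_set n n\<Omega> n\<Gamma> m At) x"
  using rom
  by (simp add: rom_solution_def rom_objective_def is_arg_min_linorder blocks_lift_map[OF g\<Omega> g\<Gamma>])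

theorem theorem6:
  fixes nsub NA m :: nat
    and N\<Omega> N\<Gamma> Nr NB n\<Omega> n\<Gamma> Np np :: "nat \<Rightarrow> nat"
    and r :: "nat \<Rightarrow> real vec \<Rightarrow> real vec \<Rightarrow> real vec"
    and A B Ahat :: "nat \<Rightarrow> real mat" and C :: "real mat"
    and g\<Omega> g\<Gamma> gp At :: "nat \<Rightarrow> real vec \<Rightarrow> real vec"
    and Q :: "nat \<Rightarrow> nat set" and lab rlab :: "nat \<Rightarrow> nat \<Rightarrow> nat \<times> nat"
    and xs xh :: "real vec" and \<kappa>l P \<kappa>u :: real
  assumes r: "\<forall>i<nsub. r i \<in> carrier_vec (N\<Omega> i) \<rightarrow> carrier_vec (N\<Gamma> i) \<rightarrow> carrier_vec (Nr i)"
    and ports: "port_numbering nsub N\<Gamma> Q Np lab"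
    and A: "equality_constraints nsub N\<Gamma> lab NA A"
    and B: "\<forall>i<nsub. B i \<in> carrier_mat (NB i) (Nr i) \<and> NB i \<le> Nr i"
    and g\<Omega>: "\<forall>i<nsub. g\<Omega> i \<in> carrier_vec (n\<Omega> i) \<rightarrow> carrier_vec (N\<Omega> i)"
    and g\<Gamma>: "\<forall>i<nsub. g\<Gamma> i \<in> carrier_vec (n\<Gamma> i) \<rightarrow> carrier_vec (N\<Gamma> i)"
    and constraints:
      "weak_FOM_port_constraints nsub n\<Gamma> NA A g\<Gamma> m C At \<or>
       strong_ROM_port_constraints nsub N\<Gamma> n\<Gamma> Q Np lab np rlab gp g\<Gamma> m Ahat At"
    and fom: "dd_fom_solution nsub N\<Omega> N\<Gamma> Nr r NA A xs"
    and rom: "rom_solution nsub n\<Omega> n\<Gamma> r B g\<Omega> g\<Gamma> m At xh"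
    and pos: "\<kappa>l > 0" "P > 0" "\<kappa>u > 0"
    and inverse_lipschitz:
      "\<forall>y\<in>carrier_vec (dd_dim N\<Omega> N\<Gamma> nsub). \<forall>z\<in>carrier_vec (dd_dim N\<Omega> N\<Gamma> nsub).
         sqrt (\<Sum>i<nsub. (l2_norm
           (r i (interior_block N\<Omega> N\<Gamma> i y) (interface_block N\<Omega> N\<Gamma> i y) -
            r i (interior_block N\<Omega> N\<Gamma> i z) (interface_block N\<Omega> N\<Gamma> i z)))\<^sup>2)
         \<ge> \<kappa>l * l2_norm (y - z)"
    and hyper_reduction:
      "\<forall>y\<in>lift_map nsub n\<Omega> n\<Gamma> g\<Omega> g\<Gamma> ` rom_feasible_set nsub n\<Omega> n\<Gamma> m At.
         sqrt (\<Sum>i<nsub. (l2_norm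
           (B i *\<^sub>v r i (interior_block N\<Omega> N\<Gamma> i y) (interface_block N\<Omega> N\<Gamma> i y)))\<^sup>2)
         \<ge> P * sqrt (\<Sum>i<nsub. (l2_norm
             (r i (interior_block N\<Omega> N\<Gamma> i y) (interface_block N\<Omega> N\<Gamma> i y)))\<^sup>2)"
    and lipschitz:
      "\<forall>y\<in>carrier_vec (dd_dim N\<Omega> N\<Gamma> nsub). \<forall>z\<in>carrier_vec (dd_dim N\<Omega> N\<Gamma> nsub).
         sqrt (\<Sum>i<nsub. (l2_norm
           (B i *\<^sub>v r i (interior_block N\<Omega> N\<Gamma> i y) (interface_block N\<Omega> N\<Gamma> i y) -
            B i *\<^sub>v r i (interior_block N\<Omega> N\<Gamma> i z) (interface_block N\<Omega> N\<Gamma> i z)))\<^sup>2)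
         \<le> \<kappa>u * l2_norm (y - z)"
  shows "l2_norm (xs - lift_map nsub n\<Omega> n\<Gamma> g\<Omega> g\<Gamma> xh)
    \<le> \<kappa>u / (P * \<kappa>l) *
       (INF w \<in> rom_feasible_set nsub n\<Omega> n\<Gamma> m At. l2_norm (xs - lift_map nsub n\<Omega> n\<Gamma> g\<Omega> g\<Gamma> w))"
proof -
  let ?g = "lift_map nsub n\<Omega> n\<Gamma> g\<Omega> g\<Gamma>" and ?S = "rom_feasible_set nsub n\<Omega> n\<Gamma> m At"
  let ?res = "\<lambda>i y. r i (interior_block N\<Omega> N\<Gamma> i y) (interface_block N\<Omega> N\<Gamma> i y)"
  let ?R = "\<lambda>w. sqrt (\<Sum>i<nsub. (l2_norm (?res i (?g w)))\<^sup>2)"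
  let ?RB = "\<lambda>w. sqrt (\<Sum>i<nsub. (l2_norm (B i *\<^sub>v ?res i (?g w)))\<^sup>2)"
  have xs: "xs \<in> carrier_vec (dd_dim N\<Omega> N\<Gamma> nsub)"
    and res_xs: "\<And>i. i < nsub \<Longrightarrow> ?res i xs = 0\<^sub>v (Nr i)"
    using fom by (auto simp: dd_fom_solution_def)
  have g: "?g w \<in> carrier_vec (dd_dim N\<Omega> N\<Gamma> nsub)" for w
    by (rule lift_map_carrier[OF g\<Omega> g\<Gamma>])
  have res: "?res i y \<in> carrier_vec (Nr i)" if "i < nsub" for i y
    using r that by (simp add: Pi_iff)
  have dist: "l2_norm (?g w - xs) = l2_norm (xs - ?g w)" for w
    using g[of w] xs by (intro l2_norm_minus_commute) simp
  \<comment> \<open>Comparison with \<open>xs\<close> turns residual differences into residuals, as \<open>xs\<close> has zero residual.\<close>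
  have diff: "?res i (?g w) - ?res i xs = ?res i (?g w)"
    and diffB: "B i *\<^sub>v ?res i (?g w) - B i *\<^sub>v ?res i xs = B i *\<^sub>v ?res i (?g w)"
    if i: "i < nsub" for i w
  proof -
    have "B i \<in> carrier_mat (NB i) (Nr i)"
      using B i by blast
    then have "B i *\<^sub>v 0\<^sub>v (Nr i) = 0\<^sub>v (NB i)" and "B i *\<^sub>v ?res i (?g w) \<in> carrier_vec (NB i)"
      using res[OF i, of "?g w"] by auto
    then show "?res i (?g w) - ?res i xs = ?res i (?g w)"
      and "B i *\<^sub>v ?res i (?g w) - B i *\<^sub>v ?res i xs = B i *\<^sub>v ?res i (?g w)"
      using res[OF i, of "?g w"] by (simp_all add: res_xs[OF i])
  qed
  have min: "is_arg_min ?RB (\<lambda>w. w \<in> ?S) xh"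
    by (rule rom_solution_minimizes_residual_norm[OF g\<Omega> g\<Gamma> rom])
  then have xh: "xh \<in> ?S"
    by (simp add: is_arg_min_def)
  show ?thesis
  proof (rule residual_minimizer_quasi_optimal[where R = ?R and RB = ?RB, OF min pos])
    show "\<kappa>l * l2_norm (xs - ?g xh) \<le> ?R xh"
      using bspec[OF bspec[OF inverse_lipschitz g[of xh]] xs] by (simp add: diff dist)
    show "P * ?R xh \<le> ?RB xh"
      using hyper_reduction xh by blast
    show "?RB w \<le> \<kappa>u * l2_norm (xs - ?g w)" for w
      using bspec[OF bspec[OF lipschitz g[of w]] xs] by (simp add: diffB dist)
  qed
qed

end
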